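(* For every $\varepsilon\in(0,1)$ and $\delta>0$ there is an $N$ such that for all $n\ge N$, every partial order on $n$ elements, and every integer $t\ge\frac{4+\delta}{\pi^2}\,n^3\log n$, the Karzanov-Khachiyan Markov chain on the linear extensions of the partial order satisfies $d(t)\le\varepsilon$. (That is, its mixing time is at most $\frac{4+o(1)}{\pi^2}n^3\log n$.)
   Context: The Karzanov-Khachiyan chain: the state is a linear extension of a fixed partial order on $n$ elements, written as a sequence. At each step choose $i\in\{1,\dots,n-1\}$ uniformly at random, and with probability $1/2$ transpose the items at positions $i$ and $i+1$, provided that doing so does not violate the partial order; otherwise do nothing. The stationary distribution $U$ is uniform on linear extensions. $d(t)=\max_x\|P_x^t-U\|_{TV}$, where $P_x^t$ is the law at time $t$ of the chain started from $x$ and $\|\cdot\|_{TV}=\frac12\|\cdot\|_1$. $\log$ is the natural logarithm. *)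

theory Defs
  imports "HOL-Probability.Probability" "HOL-Combinatorics.Multiset_Permutations"
begin

definition linear_extensions :: "'a set \<Rightarrow> 'a rel \<Rightarrow> 'a list set" where
  "linear_extensions A r =
     {xs \<in> permutations_of_set A.
        \<forall>i < length xs. \<forall>j < length xs. (xs ! i, xs ! j) \<in> r \<longrightarrow> i \<le> j}"

(* Positions are counted from 1, so the items at positions i and i+1 are xs!(i-1) and xs!i. *)
definition swap_adjacent :: "nat \<Rightarrow> 'a list \<Rightarrow> 'a list" where
  "swap_adjacent i xs = xs[i - 1 := xs ! i, i := xs ! (i - 1)]"

(* For card A <= 1 the set {1..card A - 1} is empty and this kernel is meaningless;
   use it only for card A >= 2. *)
definition kk_step :: "'a set \<Rightarrow> 'a rel \<Rightarrow> 'a list \<Rightarrow> 'a list pmf" where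
  "kk_step A r xs =
     bind_pmf (pmf_of_set {1..card A - 1}) (\<lambda>i.
     bind_pmf (bernoulli_pmf (1/2)) (\<lambda>b.
       return_pmf
         (if b \<and> swap_adjacent i xs \<in> linear_extensions A r
          then swap_adjacent i xs else xs)))"

primrec kk_law :: "'a set \<Rightarrow> 'a rel \<Rightarrow> 'a list \<Rightarrow> nat \<Rightarrow> 'a list pmf" where
  "kk_law A r x 0 = return_pmf x"
| "kk_law A r x (Suc t) = bind_pmf (kk_law A r x t) (kk_step A r)"

definition tv_dist :: "'b pmf \<Rightarrow> 'b pmf \<Rightarrow> real" where
  "tv_dist p q = (1/2) * (\<Sum>\<^sub>\<infinity>x. \<bar>pmf p x - pmf q x\<bar>)"

definition kk_dist :: "'a set \<Rightarrow> 'a rel \<Rightarrow> nat \<Rightarrow> real" where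
  "kk_dist A r t =
     Max ((\<lambda>x. tv_dist (kk_law A r x t) (pmf_of_set (linear_extensions A r)))
            ` linear_extensions A r)"

end

theory Submission
  imports Defs "HOL-Real_Asymp.Real_Asymp"
begin

text \<open>
  Path coupling in dual form. Give a pair of linear extensions that differ by a transposition of
  positions \<open>i < j\<close> the length \<open>w (i+1) + \<dots> + w j\<close>, where
  \<open>w k = sin (\<theta> (k + \<eta> n))\<close> and \<open>\<theta> = \<pi> / ((1 + 2 \<eta>) n)\<close>. Only the adjacent swaps that touch
  position \<open>i\<close> or \<open>j\<close> change this length, and their net effect telescopes to a sum of second
  differences of \<open>w\<close>; since \<open>w\<close> is an eigenvector of the discrete Laplacian, the transition operator
  contracts Lipschitz constants by \<open>1 - (1 - cos \<theta>) / (n - 1)\<close>. The shift \<open>\<eta> n\<close> keeps \<open>w\<close> bounded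
  below by a constant independent of \<open>n\<close>, at the price of a factor \<open>(1 + 2 \<eta>)\<^sup>2\<close> in the rate. As the
  diameter is at most \<open>n\<^sup>2\<close>, indicator functions are flattened after about
  \<open>2 log n / (\<pi>\<^sup>2 / (2 n\<^sup>3))\<close> steps, which is where the constant \<open>4 / \<pi>\<^sup>2\<close> comes from.
\<close>

section \<open>Linear extensions\<close>

text \<open>The contrapositive of the order condition; equal positions impose nothing. The
  \<open>sorted_wrt\<close> form splits over \<open>@\<close>, as the diameter argument
  requires.\<close>

lemma linear_extensions_iff:
  "xs \<in> linear_extensions A r \<longleftrightarrow>
     distinct xs \<and> set xs = A \<and> sorted_wrt (\<lambda>a b. (b, a) \<notin> r) xs"
  unfolding linear_extensions_def permutations_of_set_def sorted_wrt_iff_nth_less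
  by (auto simp: not_le) (meson not_le less_trans)+

lemma length_linear_extension:
  "xs \<in> linear_extensions A r \<Longrightarrow> length xs = card A"
  by (metis linear_extensions_iff distinct_card)

lemma linear_extension_order:
  assumes "xs \<in> linear_extensions A r" "i < j" "j < card A"
  shows "(xs ! j, xs ! i) \<notin> r"
  using assms length_linear_extension[OF assms(1)]
  by (auto simp: linear_extensions_iff sorted_wrt_iff_nth_less)

lemma finite_linear_extensions: "finite A \<Longrightarrow> finite (linear_extensions A r)"
  unfolding linear_extensions_def by (simp add: finite_subset)

text \<open>Sorting by the size of the down-set works: if \<open>a\<close> is strictly below
  \<open>b\<close>, transitivity puts the down-set of \<open>a\<close> inside that of
  \<open>b\<close>, and \<open>b\<close> itself is the extra member.\<close>

lemma linear_extensions_nonempty: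
  assumes "finite A" "partial_order_on A r"
  shows "linear_extensions A r \<noteq> {}"
proof -
  define down where "down a = card {b \<in> A. (b, a) \<in> r}" for a
  obtain xs where xs: "set xs = A" "distinct xs"
    using finite_distinct_list[OF assms(1)] by blast
  define ys where "ys = sort_key down xs"
  have ys: "set ys = A" "distinct ys"
    using xs by (auto simp: ys_def)
  have rfl: "refl_on A r" and tr: "trans r" and asym: "antisym r"
    using assms(2) by (auto simp: partial_order_on_def preorder_on_def)
  have down_less: "down a < down b" if "(a, b) \<in> r" "a \<noteq> b" "a \<in> A" "b \<in> A" for a b
    unfolding down_def
  proof (rule psubset_card_mono)
    have "(b, a) \<notin> r"
      using that asym by (auto dest: antisymD)
    moreover have "(b, b) \<in> r"
      using rfl that by (auto dest: refl_onD)
    ultimately show "{c \<in> A. (c, a) \<in> r} \<subset> {c \<in> A. (c, b) \<in> r}"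
      using that tr by (auto dest: transD)
  qed (use assms in auto)
  have "(ys ! j, ys ! i) \<notin> r" if "i < j" "j < length ys" for i j
  proof
    assume "(ys ! j, ys ! i) \<in> r"
    moreover have "ys ! i \<noteq> ys ! j"
      using ys that by (simp add: nth_eq_iff_index_eq)
    moreover have "ys ! i \<in> A" "ys ! j \<in> A"
      using ys that by auto
    ultimately have "down (ys ! j) < down (ys ! i)"
      using down_less by metis
    moreover have "down (ys ! i) \<le> down (ys ! j)"
      using sorted_nth_mono[OF sorted_sort_key[of down xs], of i j] that
      by (simp add: ys_def)
    ultimately show False by simp
  qed
  then have "ys \<in> linear_extensions A r"
    using ys by (auto simp: linear_extensions_iff sorted_wrt_iff_nth_less)
  then show ?thesis by blast
qed

section \<open>Transpositions of positions\<close>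

definition swap_at :: "nat \<Rightarrow> nat \<Rightarrow> 'a list \<Rightarrow> 'a list" where
  "swap_at i j xs = xs[i := xs ! j, j := xs ! i]"

lemma length_swap_at [simp]: "length (swap_at i j xs) = length xs"
  by (simp add: swap_at_def)

lemma nth_swap_at:
  assumes "i < length xs" "j < length xs" "k < length xs"
  shows "swap_at i j xs ! k = (if k = i then xs ! j else if k = j then xs ! i else xs ! k)"
  using assms by (auto simp: swap_at_def nth_list_update)

lemma swap_adjacent_eq: "swap_adjacent i xs = swap_at (i - 1) i xs"
  by (simp add: swap_adjacent_def swap_at_def)

text \<open>An adjacent swap reverses the relative order of just the two items involved, so only the
  relation between them can forbid it.\<close>

lemma swap_adjacent_mem_iff:
  assumes x: "x \<in> linear_extensions A r" and k: "0 < k" "k < card A"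
  shows "swap_adjacent k x \<in> linear_extensions A r \<longleftrightarrow> (x ! (k - 1), x ! k) \<notin> r"
proof
  have len: "length x = card A" by (rule length_linear_extension[OF x])
  {
    assume "swap_adjacent k x \<in> linear_extensions A r"
    from linear_extension_order[OF this, of "k - 1" k] show "(x ! (k - 1), x ! k) \<notin> r"
      using k len by (simp add: swap_adjacent_eq nth_swap_at split: if_splits)
  next
    assume nr: "(x ! (k - 1), x ! k) \<notin> r"
    have "(swap_adjacent k x ! j, swap_adjacent k x ! i) \<notin> r" if "i < j" "j < card A" for i j
      using that k nr linear_extension_order[OF x, of i j]
        linear_extension_order[OF x, of "k - 1" j] linear_extension_order[OF x, of k j]
        linear_extension_order[OF x, of i "k - 1"] linear_extension_order[OF x, of i k]
      by (auto simp: swap_adjacent_eq nth_swap_at len)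
    moreover have "distinct (swap_adjacent k x)" "set (swap_adjacent k x) = A"
      using x k len by (auto simp: linear_extensions_iff swap_adjacent_def)
    ultimately show "swap_adjacent k x \<in> linear_extensions A r"
      by (auto simp: linear_extensions_iff sorted_wrt_iff_nth_less swap_adjacent_eq len)
  }
qed

section \<open>The transition operator\<close>

definition kk_move :: "'a set \<Rightarrow> 'a rel \<Rightarrow> nat \<Rightarrow> 'a list \<Rightarrow> 'a list" where
  "kk_move A r i xs =
     (if swap_adjacent i xs \<in> linear_extensions A r then swap_adjacent i xs else xs)"

text \<open>The transition operator on functions: each of the \<open>card A - 1\<close> proposals
  contributes both outcomes of the fair coin.\<close>

definition kk_op :: "'a set \<Rightarrow> 'a rel \<Rightarrow> ('a list \<Rightarrow> real) \<Rightarrow> 'a list \<Rightarrow> real" where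
  "kk_op A r f x = (\<Sum>i = 1..card A - 1. f x + f (kk_move A r i x)) / (2 * real (card A - 1))"

lemma kk_move_mem:
  "x \<in> linear_extensions A r \<Longrightarrow> kk_move A r i x \<in> linear_extensions A r"
  by (simp add: kk_move_def)

lemma kk_move_involution:
  assumes "x \<in> linear_extensions A r" "0 < k" "k < card A"
  shows "kk_move A r k (kk_move A r k x) = x"
proof -
  have "swap_adjacent k (swap_adjacent k x) = x"
    using assms length_linear_extension[OF assms(1)]
    by (intro nth_equalityI) (auto simp: swap_adjacent_eq nth_swap_at)
  then show ?thesis using assms by (simp add: kk_move_def)
qed

text \<open>Stationarity of the uniform distribution: each proposal acts as an involution, hence a
  permutation, of the linear extensions.\<close>

lemma sum_kk_op:
  assumes "card A \<ge> 2"
  shows "(\<Sum>x\<in>linear_extensions A r. kk_op A r f x) = (\<Sum>x\<in>linear_extensions A r. f x)"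
proof -
  let ?E = "linear_extensions A r"
  have "(\<Sum>x\<in>?E. f (kk_move A r i x)) = (\<Sum>x\<in>?E. f x)" if "i \<in> {1..card A - 1}" for i
    using that assms
    by (intro sum.reindex_bij_witness[of _ "kk_move A r i" "kk_move A r i"])
       (auto simp: kk_move_mem kk_move_involution)
  then have "(\<Sum>i = 1..card A - 1. \<Sum>x\<in>?E. f x + f (kk_move A r i x)) =
      real (card A - 1) * (2 * (\<Sum>x\<in>?E. f x))"
    by (simp add: sum.distrib)
  then show ?thesis
    using assms unfolding kk_op_def sum_divide_distrib[symmetric]
    by (subst sum.swap) (simp del: of_nat_diff of_nat_Suc)
qed

lemma expectation_kk_step:
  assumes "card A \<ge> 2"
  shows "measure_pmf.expectation (kk_step A r x) f = kk_op A r f x"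
proof -
  let ?n = "card A - 1"
  have ne: "{1..?n} \<noteq> {}" using assms by simp
  have "measure_pmf.expectation (kk_step A r x) f =
      (\<Sum>i = 1..?n. (f x + f (kk_move A r i x)) / 2 / real ?n)"
    unfolding kk_step_def
    apply (subst pmf_expectation_bind[of "{1..?n}"])
    using ne apply auto[3]
    apply (rule sum.cong[OF refl])
    apply (subst pmf_expectation_bind[of UNIV])
    using ne by (auto simp: UNIV_bool kk_move_def field_simps)
  then show ?thesis by (simp add: kk_op_def sum_divide_distrib)
qed

lemma set_pmf_kk_step:
  assumes "x \<in> linear_extensions A r"
  shows "set_pmf (kk_step A r x) \<subseteq> linear_extensions A r"
  using assms by (auto simp: kk_step_def)

lemma set_pmf_kk_law:
  assumes "x \<in> linear_extensions A r"
  shows "set_pmf (kk_law A r x t) \<subseteq> linear_extensions A r"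
  using set_pmf_kk_step assms by (induction t) (fastforce+)

text \<open>The last step of the law is absorbed into the test function, so the induction leaves
  \<open>f\<close> arbitrary.\<close>

lemma expectation_kk_law:
  assumes "card A \<ge> 2" "x \<in> linear_extensions A r"
  shows "measure_pmf.expectation (kk_law A r x t) f = (kk_op A r ^^ t) f x"
proof (induction t arbitrary: f)
  case (Suc t)
  have fin: "finite A" using assms by (metis card.infinite not_numeral_le_zero)
  let ?E = "linear_extensions A r"
  have finE: "finite ?E" by (rule finite_linear_extensions[OF fin])
  have "measure_pmf.expectation (kk_law A r x (Suc t)) f =
      measure_pmf.expectation (bind_pmf (kk_law A r x t) (kk_step A r)) f" by simp
  also have "\<dots> = (\<Sum>a\<in>?E. pmf (kk_law A r x t) a *\<^sub>R measure_pmf.expectation (kk_step A r a) f)"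
    using set_pmf_kk_law[OF assms(2)] finE
    by (intro pmf_expectation_bind) (auto intro: finite_subset[OF set_pmf_kk_step])
  also have "\<dots> = (\<Sum>a\<in>?E. pmf (kk_law A r x t) a *\<^sub>R kk_op A r f a)"
    by (simp add: expectation_kk_step assms)
  also have "\<dots> = measure_pmf.expectation (kk_law A r x t) (kk_op A r f)"
    using set_pmf_kk_law[OF assms(2)] finE by (intro integral_measure_pmf[symmetric]) auto
  also have "\<dots> = (kk_op A r ^^ Suc t) f x"
    using Suc by (simp add: funpow_swap1)
  finally show ?case .
qed simp

section \<open>Contraction of Lipschitz constants\<close>

text \<open>A transposition of the items at the 0-based positions \<open>i < j\<close> is given the length
  \<open>w (i+1) + \<dots> + w j\<close>: the index \<open>k\<close> of \<open>w\<close> is the 1-based position of an adjacent swap.\<close>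

definition transposition_lipschitz ::
    "'a set \<Rightarrow> 'a rel \<Rightarrow> (nat \<Rightarrow> real) \<Rightarrow> real \<Rightarrow> ('a list \<Rightarrow> real) \<Rightarrow> bool" where
  "transposition_lipschitz A r w L f \<longleftrightarrow>
     (\<forall>x i j. x \<in> linear_extensions A r \<longrightarrow> i < j \<longrightarrow> j < card A \<longrightarrow>
        swap_at i j x \<in> linear_extensions A r \<longrightarrow>
        \<bar>f x - f (swap_at i j x)\<bar> \<le> L * (\<Sum>k = i + 1..j. w k))"

lemma transposition_lipschitzD:
  assumes "transposition_lipschitz A r w L f" "x \<in> linear_extensions A r"
    "y \<in> linear_extensions A r" "y = swap_at i j x" "i < j" "j < card A"
  shows "\<bar>f x - f y\<bar> \<le> L * (\<Sum>k = i + 1..j. w k)"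
  using assms unfolding transposition_lipschitz_def by blast

lemma transposition_lipschitz_move:
  assumes "transposition_lipschitz A r w L f" "x \<in> linear_extensions A r" "0 < k" "k < card A"
    "0 \<le> L" "0 \<le> w k"
  shows "\<bar>f x - f (kk_move A r k x)\<bar> \<le> L * w k"
proof (cases "swap_adjacent k x \<in> linear_extensions A r")
  case True
  then show ?thesis
    using transposition_lipschitzD[OF assms(1,2) True, of "k - 1" k] assms
    by (simp add: kk_move_def swap_adjacent_eq)
qed (use assms in \<open>simp add: kk_move_def\<close>)

text \<open>The same proposal and coin drive both states. Touching the transposed pair from outside
  (\<open>k = i\<close>, \<open>k = j + 1\<close>) lengthens the transposition by at most
  \<open>w k\<close>; touching it from inside (\<open>k = i + 1\<close>, \<open>k = j\<close>)
  shortens it by \<open>w k\<close>. The differences before and after the move share one absolute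
  value so that they can cancel when \<open>j = i + 1\<close>.\<close>

lemma kk_move_pair_bound:
  fixes f :: "'a list \<Rightarrow> real"
  assumes lip: "transposition_lipschitz A r w L f" and L: "0 \<le> L"
    and w: "\<And>k. k \<le> card A \<Longrightarrow> 0 \<le> w k"
    and x: "x \<in> linear_extensions A r" and y: "y \<in> linear_extensions A r"
    and yx: "y = swap_at i j x" and ij: "i < j" "j < card A"
    and k: "0 < k" "k < card A"
  defines "D \<equiv> \<Sum>k = i + 1..j. w k"
  shows "\<bar>(f x - f y) + (f (kk_move A r k x) - f (kk_move A r k y))\<bar> \<le>
    L * (2 * D + ((if k = i then w i else 0) + (if k = j + 1 then w (j + 1) else 0)
                  - (if k = i + 1 then w (i + 1) else 0) - (if k = j then w j else 0)))"
    (is "\<bar>_ + (f ?x' - f ?y')\<bar> \<le> L * (2 * D + ?e)")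
proof -
  note mem [simp] = swap_adjacent_mem_iff[OF x k] swap_adjacent_mem_iff[OF y k]
  have x': "?x' \<in> linear_extensions A r" and y': "?y' \<in> linear_extensions A r"
    by (simp_all add: kk_move_mem x y)
  have len [simp]: "length x = card A" by (rule length_linear_extension[OF x])
  have ny: "y ! l = (if l = i then x ! j else if l = j then x ! i else x ! l)"
    if "l < card A" for l
    using ij that by (simp add: yx nth_swap_at)
  have d: "\<bar>f x - f y\<bar> \<le> L * D"
    unfolding D_def by (rule transposition_lipschitzD[OF lip x y yx ij])
  \<comment> \<open>If at least one state stays put, the triangle inequality adds the cost of at
    most one move.\<close>
  have one_move: "\<bar>f ?x' - f ?y'\<bar> \<le> L * (D + w k)" if "?x' = x \<or> ?y' = y"
    using d transposition_lipschitz_move[OF lip x k L] transposition_lipschitz_move[OF lip y k L]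
      w[of k] k that mult_nonneg_nonneg[OF L, of "w k"] by (auto simp: algebra_simps)
  have pair: "\<bar>f ?x' - f ?y'\<bar> \<le> L * (\<Sum>k = a + 1..b. w k)"
    if "?y' = swap_at a b ?x'" "a < b" "b < card A" for a b
    by (rule transposition_lipschitzD[OF lip x' y' that])
  consider "k \<notin> {i, i + 1, j, j + 1}" | "k = i" | "k = j + 1" | "k = i + 1" "k = j"
    | "k = i + 1" "k < j" | "i + 1 < k" "k = j"
    using ij by force
  then show ?thesis
  proof cases
    case 1
    \<comment> \<open>Positions \<open>k - 1\<close> and \<open>k\<close> avoid \<open>i\<close> and
      \<open>j\<close>, so both states see the same two items, decide alike, and the swap commutes
      with the transposition.\<close>
    have "?y' = swap_at i j ?x'"
    proof (cases "(x ! (k - 1), x ! k) \<in> r")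
      case True
      then have "?x' = x" "?y' = y" using 1 k by (auto simp: kk_move_def ny)
      then show ?thesis using yx by simp
    next
      case False
      then have "?x' = swap_adjacent k x" "?y' = swap_adjacent k y"
        using 1 k by (auto simp: kk_move_def ny)
      moreover have "swap_adjacent k y = swap_at i j (swap_adjacent k x)"
        using 1 k ij by (intro nth_equalityI) (auto simp: swap_adjacent_eq nth_swap_at yx)
      ultimately show ?thesis by simp
    qed
    from pair[OF this ij] show ?thesis using d 1 by (auto simp: D_def algebra_simps)
  next
    case 2
    have "\<bar>f ?x' - f ?y'\<bar> \<le> L * (D + w k)"
    proof (cases "?x' = x \<or> ?y' = y")
      case False
      then have "?x' = swap_adjacent k x" "?y' = swap_adjacent k y"
        by (auto simp: kk_move_def split: if_splits)
      moreover have "swap_adjacent k y = swap_at (i - 1) j (swap_adjacent k x)"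
        using 2 k ij by (intro nth_equalityI) (auto simp: swap_adjacent_eq nth_swap_at yx)
      ultimately have "?y' = swap_at (i - 1) j ?x'" by simp
      from pair[OF this] have "\<bar>f ?x' - f ?y'\<bar> \<le> L * (\<Sum>l = i..j. w l)"
        using 2 k ij by simp
      also have "(\<Sum>l = i..j. w l) = D + w k"
        using ij 2 by (simp add: D_def sum.atLeast_Suc_atMost)
      finally show ?thesis .
    qed (use one_move in blast)
    then show ?thesis using d 2 ij by (auto simp: algebra_simps)
  next
    case 3
    have "\<bar>f ?x' - f ?y'\<bar> \<le> L * (D + w k)"
    proof (cases "?x' = x \<or> ?y' = y")
      case False
      then have "?x' = swap_adjacent k x" "?y' = swap_adjacent k y"
        by (auto simp: kk_move_def split: if_splits)
      moreover have "swap_adjacent k y = swap_at i (j + 1) (swap_adjacent k x)"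
        using 3 k ij by (intro nth_equalityI) (auto simp: swap_adjacent_eq nth_swap_at yx)
      ultimately have "?y' = swap_at i (j + 1) ?x'" by simp
      from pair[OF this] have "\<bar>f ?x' - f ?y'\<bar> \<le> L * (\<Sum>l = i + 1..j + 1. w l)"
        using 3 k ij by simp
      also have "(\<Sum>l = i + 1..j + 1. w l) = D + w k"
        using ij 3 by (simp add: D_def)
      finally show ?thesis .
    qed (use one_move in blast)
    then show ?thesis using d 3 ij by (auto simp: algebra_simps)
  next
    case 4
    \<comment> \<open>Here the swap exchanges \<open>x\<close> and \<open>y\<close>, so the signed
      sum vanishes, and so does the bound, as \<open>D = w k\<close>.\<close>
    have "swap_adjacent k x = y" using 4 by (simp add: yx swap_adjacent_eq)
    moreover have "swap_adjacent k y = x"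
      using 4 k by (intro nth_equalityI) (auto simp: yx swap_adjacent_eq nth_swap_at)
    ultimately have "?x' = y" "?y' = x" using x y unfolding kk_move_def by auto
    then show ?thesis using 4 by (simp add: D_def)
  next
    case 5
    \<comment> \<open>An inward swap is never blocked: in \<open>y\<close> the item
      \<open>x ! i\<close> stands at \<open>j\<close>, after \<open>x ! (i + 1)\<close>, so these
      items cannot be related in the forbidding direction. The same holds with \<open>x\<close> and
      \<open>y\<close> exchanged.\<close>
    have "(x ! (k - 1), x ! k) \<notin> r"
      using linear_extension_order[OF y, of "i + 1" j] 5 ij by (auto simp: ny)
    moreover have "(y ! (k - 1), y ! k) \<notin> r"
      using linear_extension_order[OF x, of "i + 1" j] 5 ij by (auto simp: ny)
    ultimately have "?x' = swap_adjacent k x" "?y' = swap_adjacent k y"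
      by (auto simp: kk_move_def)
    moreover have "swap_adjacent k y = swap_at (i + 1) j (swap_adjacent k x)"
      using 5 k ij by (intro nth_equalityI) (auto simp: swap_adjacent_eq nth_swap_at yx)
    ultimately have "?y' = swap_at (i + 1) j ?x'" by simp
    from pair[OF this] have "\<bar>f ?x' - f ?y'\<bar> \<le> L * (\<Sum>l = i + 1 + 1..j. w l)"
      using 5 ij by simp
    also have "(\<Sum>l = i + 1 + 1..j. w l) = D - w k"
      using 5 by (simp add: D_def sum.atLeast_Suc_atMost)
    finally show ?thesis using d 5 by (auto simp: algebra_simps)
  next
    case 6
    then have j1: "i < j - 1" "j - 1 < card A" "j - 1 \<noteq> j" using ij by simp_all
    have "(x ! (k - 1), x ! k) \<notin> r"
      using linear_extension_order[OF y j1(1,2)] j1 6 ij by (simp add: ny)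
    moreover have "(y ! (k - 1), y ! k) \<notin> r"
      using linear_extension_order[OF x j1(1,2)] j1 6 ij by (simp add: ny)
    ultimately have "?x' = swap_adjacent k x" "?y' = swap_adjacent k y"
      by (auto simp: kk_move_def)
    moreover have "swap_adjacent k y = swap_at i (j - 1) (swap_adjacent k x)"
      using 6 k ij by (intro nth_equalityI) (auto simp: swap_adjacent_eq nth_swap_at yx)
    ultimately have "?y' = swap_at i (j - 1) ?x'" by simp
    from pair[OF this] have "\<bar>f ?x' - f ?y'\<bar> \<le> L * (\<Sum>l = i + 1..j - 1. w l)"
      using 6 ij by simp
    also have "(\<Sum>l = i + 1..j - 1. w l) = D - w k"
      using 6 by (cases j) (auto simp: D_def)
    finally show ?thesis using d 6 by (auto simp: algebra_simps)
  qed
qed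

text \<open>By the eigenvector equation the slope \<open>w (j + 1) - w j\<close> changes by
  \<open>- \<gamma> * w (j + 1)\<close> when \<open>j\<close> advances by one; this
  telescopes.\<close>

lemma sum_second_difference:
  fixes w :: "nat \<Rightarrow> real"
  assumes "i \<le> j" "\<And>k. w k + w (k + 2) = (2 - \<gamma>) * w (k + 1)"
  shows "w i - w (i + 1) + w (j + 1) - w j = - \<gamma> * (\<Sum>k = i + 1..j. w k)"
  using assms(1)
proof (induction j rule: dec_induct)
  case (step j)
  have "(\<Sum>k = i + 1..Suc j. w k) = (\<Sum>k = i + 1..j. w k) + w (j + 1)"
    using step by simp
  then show ?case using step assms(2)[of j] by (simp add: algebra_simps)
qed simp

lemma kk_op_lipschitz:
  assumes lip: "transposition_lipschitz A r w L f" and L: "0 \<le> L"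
    and w: "\<And>k. k \<le> card A \<Longrightarrow> 0 \<le> w k"
    and harm: "\<And>k. w k + w (k + 2) = (2 - \<gamma>) * w (k + 1)"
    and n: "card A \<ge> 2"
  shows "transposition_lipschitz A r w (L * (1 - \<gamma> / (2 * real (card A - 1)))) (kk_op A r f)"
  unfolding transposition_lipschitz_def
proof (intro allI impI)
  fix x i j
  assume x: "x \<in> linear_extensions A r" and ij: "i < j" "j < card A"
    and y: "swap_at i j x \<in> linear_extensions A r"
  let ?y = "swap_at i j x" and ?n = "card A - 1"
  define D where "D = (\<Sum>k = i + 1..j. w k)"
  define e where "e k = (if k = i then w i else 0) + (if k = j + 1 then w (j + 1) else 0)
      - (if k = i + 1 then w (i + 1) else 0) - (if k = j then w j else 0)" for k
  have "\<bar>\<Sum>k = 1..?n. (f x - f ?y) + (f (kk_move A r k x) - f (kk_move A r k ?y))\<bar>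
      \<le> (\<Sum>k = 1..?n. L * (2 * D + e k))"
    unfolding D_def e_def
    by (intro order_trans[OF sum_abs] sum_mono kk_move_pair_bound[OF lip L w x y refl ij]) auto
  also have "\<dots> = L * (2 * real ?n * D + (\<Sum>k = 1..?n. e k))"
    by (simp add: sum_distrib_left[symmetric] sum.distrib)
  \<comment> \<open>Only an inequality: for \<open>i = 0\<close> or \<open>j + 1 = card A\<close>
    the outward proposal does not exist, and its nonnegative weight is added for free.\<close>
  also have "(\<Sum>k = 1..?n. e k) \<le> w i - w (i + 1) + w (j + 1) - w j"
    using ij w[of i] w[of "j + 1"] by (auto simp: e_def sum.distrib sum_subtractf)
  also have "\<dots> = - \<gamma> * D"
    unfolding D_def using ij by (intro sum_second_difference harm) auto
  finally have le: "\<bar>\<Sum>k = 1..?n. (f x - f ?y) + (f (kk_move A r k x) - f (kk_move A r k ?y))\<bar>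
      \<le> L * (2 * real ?n * D + - \<gamma> * D)"
    using L by (simp add: mult_left_mono)
  have "kk_op A r f x - kk_op A r f ?y =
      (\<Sum>k = 1..?n. (f x - f ?y) + (f (kk_move A r k x) - f (kk_move A r k ?y))) / (2 * real ?n)"
    unfolding kk_op_def diff_divide_distrib[symmetric] sum_subtractf[symmetric]
    by (simp add: algebra_simps)
  then have "\<bar>kk_op A r f x - kk_op A r f ?y\<bar> \<le> L * (2 * real ?n * D + - \<gamma> * D) / (2 * real ?n)"
    using le by (simp add: divide_right_mono)
  also have "\<dots> = L * (1 - \<gamma> / (2 * real ?n)) * D"
    using n by (simp add: field_simps)
  finally show "\<bar>kk_op A r f x - kk_op A r f ?y\<bar> \<le> L * (1 - \<gamma> / (2 * real ?n)) * (\<Sum>k = i + 1..j. w k)"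
    by (simp add: D_def)
qed

text \<open>The bound on \<open>\<gamma>\<close> keeps the contraction factor nonnegative, so every
  iterate meets the condition \<open>0 \<le> L\<close> of the single step.\<close>

lemma kk_op_power_lipschitz:
  assumes "transposition_lipschitz A r w L f" "0 \<le> L"
    and "\<And>k. k \<le> card A \<Longrightarrow> 0 \<le> w k"
    and "\<And>k. w k + w (k + 2) = (2 - \<gamma>) * w (k + 1)"
    and "card A \<ge> 2" and "\<gamma> \<le> 2 * real (card A - 1)"
  shows "transposition_lipschitz A r w (L * (1 - \<gamma> / (2 * real (card A - 1))) ^ t)
    ((kk_op A r ^^ t) f)"
proof (induction t)
  case (Suc t)
  have "0 \<le> 1 - \<gamma> / (2 * real (card A - 1))" using assms by simp
  then have "0 \<le> L * (1 - \<gamma> / (2 * real (card A - 1))) ^ t" using assms by simp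
  from kk_op_lipschitz[OF Suc this assms(3-5)] show ?case
    by (simp add: mult_ac)
qed (use assms in simp)

section \<open>Diameter\<close>

text \<open>Item \<open>a\<close> moves left past \<open>u\<close> one adjacent swap at a time,
  beginning with the last item of \<open>u\<close>; hence the reverse induction.\<close>

lemma bubble_bound:
  fixes f :: "'a list \<Rightarrow> real"
  assumes adj: "\<And>x k. x \<in> linear_extensions A r \<Longrightarrow> 0 < k \<Longrightarrow> k < card A \<Longrightarrow>
      swap_adjacent k x \<in> linear_extensions A r \<Longrightarrow> \<bar>f x - f (swap_adjacent k x)\<bar> \<le> c"
    and "p @ u @ a # v \<in> linear_extensions A r" "\<And>b. b \<in> set u \<Longrightarrow> (b, a) \<notin> r"
  shows "p @ a # u @ v \<in> linear_extensions A r \<and>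
    \<bar>f (p @ u @ a # v) - f (p @ a # u @ v)\<bar> \<le> c * length u"
  using assms(2,3)
proof (induction u arbitrary: v rule: rev_induct)
  case (snoc b u)
  let ?x = "p @ (u @ [b]) @ a # v" and ?y = "p @ u @ a # b # v"
  \<comment> \<open>This is the 1-based position of \<open>b\<close>, as
    \<open>swap_adjacent\<close> expects; \<open>a\<close> comes right after it.\<close>
  let ?k = "length p + length u + 1"
  have y: "?y \<in> linear_extensions A r"
    using snoc.prems by (auto simp: linear_extensions_iff sorted_wrt_append)
  have k: "?k < card A" using length_linear_extension[OF y] by simp
  have "swap_adjacent ?k ?x = ?y"
    by (simp add: swap_adjacent_def nth_append list_update_append)
  with adj[of ?x ?k] y k snoc.prems have "\<bar>f ?x - f ?y\<bar> \<le> c" by simp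
  moreover have "p @ a # u @ b # v \<in> linear_extensions A r \<and>
    \<bar>f ?y - f (p @ a # u @ b # v)\<bar> \<le> c * length u"
    using snoc.IH[of "b # v"] y snoc.prems by simp
  ultimately show ?case by (auto simp: algebra_simps)
qed simp

text \<open>The first item of the target tail \<open>v\<close> is bubbled to the front of
  \<open>u\<close> and joins the common prefix. The items it passes come later in the target, so no
  swap is blocked. Each of the \<open>length v\<close> rounds takes at most \<open>card A\<close>
  swaps.\<close>

lemma linear_extensions_diameter:
  fixes f :: "'a list \<Rightarrow> real"
  assumes adj: "\<And>x k. x \<in> linear_extensions A r \<Longrightarrow> 0 < k \<Longrightarrow> k < card A \<Longrightarrow>
      swap_adjacent k x \<in> linear_extensions A r \<Longrightarrow> \<bar>f x - f (swap_adjacent k x)\<bar> \<le> c"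
    and c: "0 \<le> c"
    and "p @ u \<in> linear_extensions A r" "p @ v \<in> linear_extensions A r"
  shows "\<bar>f (p @ u) - f (p @ v)\<bar> \<le> c * real (length v * card A)"
  using assms(3,4)
proof (induction v arbitrary: p u)
  case Nil
  then have "length (p @ u) = length (p @ [])"
    by (metis length_linear_extension)
  then show ?case by simp
next
  case (Cons a v)
  have "set u = insert a (set v)"
    using Cons.prems by (auto simp: linear_extensions_iff)
  then obtain u1 u2 where u: "u = u1 @ a # u2"
    by (metis insertI1 split_list)
  have "(b, a) \<notin> r" if "b \<in> set u1" for b
  proof -
    have "b \<in> set v"
      using that \<open>set u = _\<close> Cons.prems(1) u by (auto simp: linear_extensions_iff)
    then show ?thesis using Cons.prems(2) by (auto simp: linear_extensions_iff sorted_wrt_append)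
  qed
  then have b: "p @ a # u1 @ u2 \<in> linear_extensions A r"
    "\<bar>f (p @ u) - f (p @ a # u1 @ u2)\<bar> \<le> c * length u1"
    using bubble_bound[where A = A and r = r and f = f and c = c and p = p and u = u1 and a = a
      and v = u2] adj Cons.prems u by auto
  have "length u1 \<le> card A"
    using length_linear_extension[OF Cons.prems(1)] u by simp
  then have "c * length u1 \<le> c * card A" using c by (simp add: mult_left_mono)
  moreover have "\<bar>f (p @ a # u1 @ u2) - f (p @ a # v)\<bar> \<le> c * real (length v * card A)"
    using Cons.IH[of "p @ [a]" "u1 @ u2"] Cons.prems b by simp
  ultimately show ?case using b(2) by (simp add: algebra_simps)
qed

section \<open>Total variation bound\<close>

text \<open>Both mass functions sum to 1, so positive and negative parts of their difference
  balance, and the distance is attained at the event \<open>S\<close> where \<open>p\<close> is at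
  least \<open>q\<close>.\<close>

lemma tv_dist_le:
  assumes "finite E" "set_pmf p \<subseteq> E" "set_pmf q \<subseteq> E"
    and le: "\<And>S. S \<subseteq> E \<Longrightarrow> measure_pmf.prob p S - measure_pmf.prob q S \<le> B"
  shows "tv_dist p q \<le> B"
proof -
  define S where "S = {x \<in> E. pmf q x \<le> pmf p x}"
  have z: "pmf p x = 0" "pmf q x = 0" if "x \<notin> E" for x
    using assms that by (auto simp: set_pmf_iff)
  have one: "sum (pmf p) E = 1" "sum (pmf q) E = 1"
    using assms by (auto intro: sum_pmf_eq_1)
  have "(\<Sum>\<^sub>\<infinity>x. \<bar>pmf p x - pmf q x\<bar>) = (\<Sum>\<^sub>\<infinity>x\<in>E. \<bar>pmf p x - pmf q x\<bar>)"
    by (rule infsum_cong_neutral) (auto simp: z)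
  also have "\<dots> = (\<Sum>x\<in>E. \<bar>pmf p x - pmf q x\<bar>)" using assms by simp
  also have "\<dots> = (\<Sum>x\<in>E. 2 * (if pmf q x \<le> pmf p x then pmf p x - pmf q x else 0)
      - (pmf p x - pmf q x))"
    by (rule sum.cong) auto
  also have "\<dots> = 2 * (\<Sum>x\<in>E. if pmf q x \<le> pmf p x then pmf p x - pmf q x else 0)"
    using one by (simp add: sum_subtractf sum_distrib_left[symmetric])
  also have "\<dots> = 2 * (\<Sum>x\<in>S. pmf p x - pmf q x)"
    using assms(1) unfolding S_def by (subst sum.inter_filter) auto
  finally have "tv_dist p q = measure_pmf.prob p S - measure_pmf.prob q S"
    using assms(1) by (simp add: tv_dist_def measure_measure_pmf_finite S_def sum_subtractf)
  then show ?thesis using le[of S] by (auto simp: S_def)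
qed

text \<open>For an event \<open>S\<close>, \<open>g\<close> maps a start to the probability of
  \<open>S\<close> at time \<open>t\<close>. Contraction and the diameter bound limit the
  oscillation of \<open>g\<close>, and by stationarity its mean is the uniform probability of
  \<open>S\<close>.\<close>

lemma kk_dist_le:
  assumes fin: "finite A" and po: "partial_order_on A r" and n: "card A \<ge> 2"
    and w: "\<And>k. k \<le> card A \<Longrightarrow> m \<le> w k" "\<And>k. k \<le> card A \<Longrightarrow> w k \<le> 1"
    and m: "0 < m"
    and harm: "\<And>k. w k + w (k + 2) = (2 - \<gamma>) * w (k + 1)"
    and \<gamma>: "\<gamma> \<le> 2 * real (card A - 1)"
  shows "kk_dist A r t \<le> (1 - \<gamma> / (2 * real (card A - 1))) ^ t * real (card A)^2 / m"
proof -
  let ?E = "linear_extensions A r" and ?n = "card A"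
  let ?q = "1 - \<gamma> / (2 * real (card A - 1))"
  have finE: "finite ?E" and neE: "?E \<noteq> {}"
    using finite_linear_extensions[OF fin] linear_extensions_nonempty[OF fin po] by auto
  have q0: "0 \<le> ?q" using n \<gamma> by simp
  have w0: "\<And>k. k \<le> card A \<Longrightarrow> 0 \<le> w k" using w(1) m by (meson less_imp_le order_trans)
  have tv: "tv_dist (kk_law A r x t) (pmf_of_set ?E) \<le> ?q ^ t * real ?n^2 / m" if x: "x \<in> ?E" for x
  proof (rule tv_dist_le[OF finE])
    show "set_pmf (kk_law A r x t) \<subseteq> ?E" by (rule set_pmf_kk_law[OF x])
    show "set_pmf (pmf_of_set ?E) \<subseteq> ?E" using finE neE by simp
    fix S assume S: "S \<subseteq> ?E"
    define f where "f = (indicator S :: 'a list \<Rightarrow> real)"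
    define g where "g = (kk_op A r ^^ t) f"
    have "transposition_lipschitz A r w (1 / m) f"
      unfolding transposition_lipschitz_def
    proof (intro allI impI)
      fix x i j assume ij: "i < j" "j < card A"
      \<comment> \<open>One weight already makes every transposition at least \<open>m\<close> long,
        so an indicator has Lipschitz constant \<open>1 / m\<close>.\<close>
      have "m \<le> w j" using w(1) ij by simp
      also have "w j \<le> (\<Sum>k = i + 1..j. w k)"
        using ij w0 by (intro member_le_sum) auto
      finally have "1 \<le> 1 / m * (\<Sum>k = i + 1..j. w k)" using m by (simp add: field_simps)
      moreover have "\<bar>f x - f (swap_at i j x)\<bar> \<le> 1" by (simp add: f_def indicator_def)
      ultimately show "\<bar>f x - f (swap_at i j x)\<bar> \<le> 1 / m * (\<Sum>k = i + 1..j. w k)" by linarith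
    qed
    then have lip: "transposition_lipschitz A r w (1 / m * ?q ^ t) g"
      unfolding g_def using m w0 harm n \<gamma> by (intro kk_op_power_lipschitz) auto
    have c0: "0 \<le> 1 / m * ?q ^ t" using m q0 by simp
    have adj: "\<bar>g y - g (swap_adjacent k y)\<bar> \<le> 1 / m * ?q ^ t"
      if "y \<in> ?E" "0 < k" "k < ?n" "swap_adjacent k y \<in> ?E" for y k
    proof -
      have "\<bar>g y - g (swap_adjacent k y)\<bar> \<le> 1 / m * ?q ^ t * w k"
        using transposition_lipschitz_move[OF lip that(1-3) c0] w0[of k] that
        by (simp add: kk_move_def)
      also have "\<dots> \<le> 1 / m * ?q ^ t * 1"
        using c0 w(2)[of k] that by (intro mult_left_mono) auto
      finally show ?thesis by simp
    qed
    have close: "g x - g y \<le> ?q ^ t * real ?n^2 / m" if y: "y \<in> ?E" for y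
    proof -
      have "\<bar>g ([] @ x) - g ([] @ y)\<bar> \<le> 1 / m * ?q ^ t * real (length y * ?n)"
        by (rule linear_extensions_diameter[OF _ c0]) (use adj x y in auto)
      then show ?thesis
        using length_linear_extension[OF y] by (simp add: power2_eq_square mult_ac)
    qed
    have "(\<Sum>y\<in>?E. g y) = (\<Sum>y\<in>?E. f y)"
      unfolding g_def by (induction t) (simp_all add: sum_kk_op[OF n])
    also have "\<dots> = real (card S)"
      using S finE by (simp add: f_def indicator_def Int_absorb1)
    finally have U: "(\<Sum>y\<in>?E. g y) / card ?E = measure_pmf.prob (pmf_of_set ?E) S"
      using S finE neE by (simp add: measure_pmf_of_set Int_absorb1)
    have "measure_pmf.prob (kk_law A r x t) S = g x"
      using expectation_kk_law[OF n x, of t f] by (simp add: f_def g_def)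
    then have "measure_pmf.prob (kk_law A r x t) S - measure_pmf.prob (pmf_of_set ?E) S =
        (\<Sum>y\<in>?E. g x - g y) / card ?E"
      unfolding U[symmetric] using finE neE by (simp add: sum_subtractf field_simps)
    also have "\<dots> \<le> (\<Sum>y\<in>?E. ?q ^ t * real ?n^2 / m) / card ?E"
      by (intro divide_right_mono sum_mono close) auto
    also have "\<dots> = ?q ^ t * real ?n^2 / m" using finE neE by simp
    finally show "measure_pmf.prob (kk_law A r x t) S - measure_pmf.prob (pmf_of_set ?E) S
      \<le> ?q ^ t * real ?n^2 / m" .
  qed
  then show ?thesis unfolding kk_dist_def using finE neE by (subst Max_le_iff) auto
qed

section \<open>Sine weights and the explicit rate\<close>

lemma kk_dist_le_exp:
  assumes "finite A" "partial_order_on A r" "card A \<ge> 2" and \<eta>: "0 < \<eta>"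
  shows "kk_dist A r t \<le>
    exp (- (1 - cos (pi / ((1 + 2 * \<eta>) * real (card A)))) * real t / real (card A))
    * real (card A)^2 / sin (pi * \<eta> / (1 + 2 * \<eta>))"
proof -
  define n where "n = card A"
  define \<theta> where "\<theta> = pi / ((1 + 2 * \<eta>) * real n)"
  define m where "m = sin (pi * \<eta> / (1 + 2 * \<eta>))"
  define w where "w k = sin (\<theta> * (real k + \<eta> * real n))" for k :: nat
  let ?\<gamma> = "2 - 2 * cos \<theta>"
  have n: "n \<ge> 2" using assms by (simp add: n_def)
  have \<theta>: "0 < \<theta>" using n \<eta> by (simp add: \<theta>_def)
  \<comment> \<open>\<open>lo\<close> is the sine argument at \<open>k = 0\<close>;
    \<open>tot\<close> says that the range \<open>0..n\<close> and its two equal margins fill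
    \<open>[0, pi]\<close>.\<close>
  have lo: "\<theta> * (\<eta> * real n) = pi * \<eta> / (1 + 2 * \<eta>)"
    and tot: "\<theta> * (real n + 2 * (\<eta> * real n)) = pi"
    using n \<eta> by (simp_all add: \<theta>_def divide_simps add_pos_pos less_imp_neq[symmetric])
       (simp_all add: algebra_simps)
  have m0: "0 < m" unfolding m_def using \<eta> by (intro sin_gt_zero) (auto simp: field_simps add_pos_pos)
  have wm: "m \<le> w k" if "k \<le> n" for k
  proof -
    \<comment> \<open>Recentred at \<open>pi / 2\<close>, the weights are cosines of small
      arguments, and monotonicity of \<open>cos\<close> on \<open>[0, pi]\<close> bounds them below
      by the endpoint value \<open>m\<close>.\<close>
    have eq: "w k = cos (\<theta> * (real k + \<eta> * real n) - pi / 2)" for k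
      by (simp add: w_def cos_diff)
    have m: "m = cos (pi / 2 - \<theta> * (\<eta> * real n))" 
      by (simp add: m_def lo cos_diff)
    have "\<bar>\<theta> * (real k + \<eta> * real n) - pi / 2\<bar> \<le> pi / 2 - \<theta> * (\<eta> * real n)"
    proof -
      have "0 \<le> \<theta> * real k" "\<theta> * real k \<le> \<theta> * real n"
        using \<theta> that by auto
      moreover have "\<theta> * real n + 2 * (\<theta> * (\<eta> * real n)) = pi"
        using tot by (simp add: algebra_simps)
      ultimately show ?thesis unfolding abs_le_iff distrib_left by linarith
    qed
    moreover have "pi / 2 - \<theta> * (\<eta> * real n) \<le> pi"
      using \<theta> \<eta> pi_gt_zero by (smt (verit) field_sum_of_halves mult_nonneg_nonneg of_nat_0_le_iff)
    ultimately have "cos (pi / 2 - \<theta> * (\<eta> * real n)) \<le>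
        cos \<bar>\<theta> * (real k + \<eta> * real n) - pi / 2\<bar>"
      by (intro cos_monotone_0_pi_le) auto
    then show ?thesis by (simp add: eq m)
  qed
  have harm: "w k + w (k + 2) = (2 - ?\<gamma>) * w (k + 1)" for k
  proof -
    define a where "a = \<theta> * (real (k + 1) + \<eta> * real n)"
    have "w k = sin (a - \<theta>)" "w (k + 2) = sin (a + \<theta>)" "w (k + 1) = sin a"
      by (simp_all add: w_def a_def algebra_simps)
    then show ?thesis by (simp add: sin_add sin_diff)
  qed
  \<comment> \<open>As \<open>n \<ge> 2\<close>, \<open>\<theta> \<le> pi / 2\<close>; hence
    \<open>cos \<theta> \<ge> 0\<close> and \<open>?\<gamma> \<le> 2\<close>.\<close>
  have lam: "?\<gamma> \<le> 2 * real (n - 1)"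
  proof -
    have "\<theta> * 2 \<le> \<theta> * (real n + 2 * (\<eta> * real n))"
      using \<theta> n \<eta> by (intro mult_left_mono) (auto intro: order_trans[of _ "real n"])
    then have "0 \<le> cos \<theta>" using tot \<theta> by (intro cos_ge_zero) auto
    moreover have "1 \<le> real (n - 1)" using n by simp
    ultimately show ?thesis by linarith
  qed
  have q: "1 - ?\<gamma> / (2 * real (n - 1)) \<le> exp (- (1 - cos \<theta>) / real n)"
  proof -
    have "1 - ?\<gamma> / (2 * real (n - 1)) = 1 - (1 - cos \<theta>) / real (n - 1)"
      using n by (simp add: field_simps)
    also have "\<dots> \<le> 1 + - (1 - cos \<theta>) / real n"
    proof -
      have "(1 - cos \<theta>) / real n \<le> (1 - cos \<theta>) / real (n - 1)"
        using n by (intro divide_left_mono) auto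
      from diff_left_mono[OF this, of 1] show ?thesis
        by (simp only: minus_divide_left[symmetric] diff_conv_add_uminus)
    qed
    also have "\<dots> \<le> exp (- (1 - cos \<theta>) / real n)"
      by (rule exp_ge_add_one_self)
    finally show ?thesis .
  qed
  have "kk_dist A r t \<le> (1 - ?\<gamma> / (2 * real (n - 1))) ^ t * real n^2 / m"
    using kk_dist_le[OF assms(1-3), of m w ?\<gamma> t] wm m0 harm lam
    by (auto simp: n_def w_def)
  also have "\<dots> \<le> exp (- (1 - cos \<theta>) / real n) ^ t * real n^2 / m"
    using q n lam m0 by (intro divide_right_mono mult_right_mono power_mono) auto
  also have "exp (- (1 - cos \<theta>) / real n) ^ t = exp (- (1 - cos \<theta>) * real t / real n)"
    by (simp add: exp_of_nat_mult[symmetric] mult_ac)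
  finally show ?thesis by (simp add: n_def \<theta>_def m_def)
qed

section \<open>Choice of constants and the limit of large \<open>n\<close>\<close>

theorem mainTheorem7:
  fixes \<epsilon> \<delta> :: real
  assumes "0 < \<epsilon>" and "\<epsilon> < 1" and "0 < \<delta>"
  shows "\<exists>N::nat. \<forall>n\<ge>N. \<forall>(A :: 'a set) r.
           finite A \<and> card A = n \<and> partial_order_on A r \<longrightarrow>
           (\<forall>t::nat. real t \<ge> (4 + \<delta>) / pi\<^sup>2 * real n ^ 3 * ln (real n) \<longrightarrow>
              kk_dist A r t \<le> \<epsilon>)"
proof -
  \<comment> \<open>\<open>c\<close> will be \<open>1 + 2 * \<eta>\<close>. The loss
    \<open>c^2\<close> in the rate is set to use up half of the slack, turning
    \<open>4 + \<delta>\<close> into \<open>4 + \<delta> / 2\<close>.\<close>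
  define c where "c = sqrt ((4 + \<delta>) / (4 + \<delta> / 2))"
  define \<eta> where "\<eta> = (c - 1) / 2"
  have c2: "c\<^sup>2 = (4 + \<delta>) / (4 + \<delta> / 2)" using assms by (simp add: c_def)
  have "1 < c" unfolding c_def using assms by (simp add: field_simps)
  then have \<eta>: "0 < \<eta>" "1 + 2 * \<eta> = c" by (simp_all add: \<eta>_def field_simps)
  define m where "m = sin (pi * \<eta> / (1 + 2 * \<eta>))"
  have m0: "0 < m" unfolding m_def using \<eta>(1) by (intro sin_gt_zero) (auto simp: field_simps add_pos_pos)
  \<comment> \<open>The rescaled gap; it converges because \<open>1 - cos x\<close> behaves like
    \<open>x^2 / 2\<close> near 0.\<close>
  define a where "a n = (1 - cos (pi / (c * real n))) * real n^2" for n :: nat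
  have "a \<longlonglongrightarrow> pi\<^sup>2 / (2 * c\<^sup>2)"
    unfolding a_def using \<open>1 < c\<close>
    by real_asymp (simp add: power2_eq_square field_simps)
  then have "(\<lambda>n. a n * ((4 + \<delta>) / pi\<^sup>2)) \<longlonglongrightarrow> pi\<^sup>2 / (2 * c\<^sup>2) * ((4 + \<delta>) / pi\<^sup>2)"
    by (intro tendsto_intros)
  also have "pi\<^sup>2 / (2 * c\<^sup>2) * ((4 + \<delta>) / pi\<^sup>2) = 2 + \<delta> / 4"
  proof -
    have "p / (2 * (x / y)) * (x / p) = y / 2" if "p \<noteq> 0" "x \<noteq> 0" for p x y :: real
      using that by simp
    from this[of "pi\<^sup>2" "4 + \<delta>" "4 + \<delta> / 2"] show ?thesis
      unfolding c2 using assms by (simp add: add_divide_distrib)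
  qed
  \<comment> \<open>In the exponent \<open>2\<close> cancels the diameter factor \<open>n^2\<close>,
    and \<open>\<delta> / 8\<close> remains to beat the constant \<open>1 / m\<close>.\<close>
  finally have ev1: "\<forall>\<^sub>F n in sequentially. a n * ((4 + \<delta>) / pi\<^sup>2) > 2 + \<delta> / 8"
    by (rule order_tendstoD) (use assms in simp)
  have "(\<lambda>n. real n powr (- \<delta> / 8) / m) \<longlonglongrightarrow> 0"
    using assms m0 by real_asymp
  then have ev2: "\<forall>\<^sub>F n in sequentially. real n powr (- \<delta> / 8) / m < \<epsilon>"
    by (rule order_tendstoD) (use assms in simp)
  \<comment> \<open>Both asymptotic facts involve \<open>n\<close> alone, so one threshold serves
    all partial orders and all \<open>t\<close>.\<close>
  have "\<forall>\<^sub>F n in sequentially. \<forall>(A :: 'a set) r.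
           finite A \<and> card A = n \<and> partial_order_on A r \<longrightarrow>
           (\<forall>t::nat. real t \<ge> (4 + \<delta>) / pi\<^sup>2 * real n ^ 3 * ln (real n) \<longrightarrow>
              kk_dist A r t \<le> \<epsilon>)"
    using ev1 ev2 eventually_ge_at_top[of 2]
  proof eventually_elim
    case (elim n)
    show ?case
    proof (intro allI impI)
      fix A :: "'a set" and r t
      assume A: "finite A \<and> card A = n \<and> partial_order_on A r"
        and t: "real t \<ge> (4 + \<delta>) / pi\<^sup>2 * real n ^ 3 * ln (real n)"
      have cos1: "0 \<le> 1 - cos (pi / (c * real n))" by simp
      have "(2 + \<delta> / 8) * ln (real n) \<le> a n * ((4 + \<delta>) / pi\<^sup>2) * ln (real n)"
        using elim by (intro mult_right_mono) auto
      also have "\<dots> = (1 - cos (pi / (c * real n))) * ((4 + \<delta>) / pi\<^sup>2 * real n ^ 3 * ln (real n)) / real n"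
        using elim by (simp add: a_def power2_eq_square power3_eq_cube)
      also have "\<dots> \<le> (1 - cos (pi / (c * real n))) * real t / real n"
        using t cos1 by (intro divide_right_mono mult_left_mono) auto
      finally have le: "- (1 - cos (pi / (c * real n))) * real t / real n \<le> - (2 + \<delta> / 8) * ln (real n)"
        by (simp only: mult_minus_left minus_divide_left[symmetric] neg_le_iff_le)
      have "kk_dist A r t \<le>
          exp (- (1 - cos (pi / (c * real n))) * real t / real n) * real n^2 / m"
        using kk_dist_le_exp[of A r \<eta> t] A elim \<eta> by (simp add: m_def)
      also have "\<dots> \<le> exp (- (2 + \<delta> / 8) * ln (real n)) * real n^2 / m"
        using le m0 by (intro divide_right_mono mult_right_mono) auto
      also have "exp (- (2 + \<delta> / 8) * ln (real n)) * real n^2 = real n powr (- \<delta> / 8)"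
      proof -
        have "real n^2 = real n powr 2" using elim by simp
        moreover have "exp (- (2 + \<delta> / 8) * ln (real n)) = real n powr (- (2 + \<delta> / 8))"
          using elim by (simp add: powr_def)
        ultimately show ?thesis by (simp only: powr_add[symmetric]) simp
      qed
      finally show "kk_dist A r t \<le> \<epsilon>" using elim by linarith
    qed
  qed
  then show ?thesis by (simp add: eventually_sequentially)
qed

end
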